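(* Let $m>n\geq 0$ and $1\leq d\leq m$ be integers. Then $$E_{2m}(q)\equiv q^{m-n}E_{2n}(q)\pmod{1+q^d}\quad\text{if and only if}\quad m\equiv n\pmod d.$$
   Context: For $n\ge 1$ let $(a;q)_n=(1-a)(1-aq)\cdots(1-aq^{n-1})$, and $(a;q)_0=1$. The $q$-Euler numbers $E_{2n}(q)$ are defined by the formal power series identity $$\sum_{n=0}^{\infty}E_{2n}(q)\frac{x^{2n}}{(q;q)_{2n}}=\left(\sum_{n=0}^{\infty}\frac{x^{2n}}{(q;q)_{2n}}\right)^{-1}.$$ They are polynomials in $q$ with integer coefficients. Congruences between polynomials modulo a polynomial are understood in $\mathbb{Z}[q]$: $A(q)\equiv B(q)\pmod{C(q)}$ means that $C(q)$ divides $A(q)-B(q)$ in $\mathbb{Z}[q]$. *)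

theory Defs
  imports
    "HOL-Computational_Algebra.Computational_Algebra"
    "HOL-Number_Theory.Cong"
begin

definition qpoch :: "'a::comm_ring_1 \<Rightarrow> 'a \<Rightarrow> nat \<Rightarrow> 'a" where
  "qpoch a q n = (\<Prod>k<n. 1 - a * q ^ k)"

abbreviation q_var :: "int poly" where
  "q_var \<equiv> [:0, 1:]"

(* Power series in x over the field Q(q), realised as the fraction field of Z[q]. *)
definition q_even_series :: "(nat \<Rightarrow> int poly) \<Rightarrow> int poly fract fps" where
  "q_even_series c =
     Abs_fps (\<lambda>k. if even k then to_fract (c k) / to_fract (qpoch q_var q_var k) else 0)"

(* q_euler k is E_k(q): the k-th coefficient of the reciprocal series times (q;q)_k lies in
   Z[q] (see to_fract_q_euler), and it vanishes for odd k (see q_euler_odd). *)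
definition q_euler :: "nat \<Rightarrow> int poly" where
  "q_euler k =
     (THE p. to_fract p =
        fps_nth (inverse (q_even_series (\<lambda>_. 1))) k * to_fract (qpoch q_var q_var k))"

lemma qpoch_0 [simp]: "qpoch a q 0 = 1"
  by (simp add: qpoch_def)

lemma qpoch_Suc: "qpoch a q (Suc n) = qpoch a q n * (1 - a * q ^ n)"
  by (simp add: qpoch_def)

lemma qpoch_q_nonzero [simp]: "qpoch q_var q_var n \<noteq> 0"
proof -
  have "poly (qpoch q_var q_var n) 0 = 1"
    by (simp add: qpoch_def poly_prod)
  then show ?thesis
    by auto
qed

lemma qpoch_mult_dvd:
  fixes q :: "'a::comm_ring_1"
  shows "qpoch q q i * qpoch q q j dvd qpoch q q (i + j)"
proof (induction "i + j" arbitrary: i j rule: less_induct)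
  case less
  show ?case
  proof (cases i; cases j)
    fix i' j' assume ij: "i = Suc i'" "j = Suc j'"
    have 1: "qpoch q q i' * qpoch q q j dvd qpoch q q (i' + j)"
      and 2: "qpoch q q i * qpoch q q j' dvd qpoch q q (i + j')"
      using less[of i' j] less[of i j'] ij by auto
    have "qpoch q q (i + j) = qpoch q q (i' + j) * (1 - q ^ i)
        + q ^ i * (qpoch q q (i + j') * (1 - q ^ j))"
      using ij by (simp add: qpoch_Suc algebra_simps power_add)
    moreover have "qpoch q q i * qpoch q q j dvd qpoch q q (i' + j) * (1 - q ^ i)"
      using mult_dvd_mono[OF 1 dvd_refl[of "1 - q ^ i"]] ij by (simp add: qpoch_Suc mult_ac)
    moreover have "qpoch q q i * qpoch q q j dvd q ^ i * (qpoch q q (i + j') * (1 - q ^ j))"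
    proof (rule dvd_mult)
      show "qpoch q q i * qpoch q q j dvd qpoch q q (i + j') * (1 - q ^ j)"
        using mult_dvd_mono[OF 2 dvd_refl[of "1 - q ^ j"]] ij(2)
        by (simp add: qpoch_Suc mult_ac)
    qed
    ultimately show ?thesis
      by (metis dvd_add)
  qed simp_all
qed

lemma reciprocal_coeff_integral:
  "\<exists>p. to_fract p =
     fps_nth (inverse (q_even_series (\<lambda>_. 1))) n * to_fract (qpoch q_var q_var n)"
proof (induction n rule: less_induct)
  case (less n)
  define F where "F = q_even_series (\<lambda>_. 1)"
  define G where "G = inverse F"
  have F0: "fps_nth F 0 = 1"
    by (simp add: F_def q_even_series_def)
  have GF: "G * F = 1"
    using inverse_mult_eq_1[of F] F0 by (simp add: G_def)
  define R where "R = range (to_fract :: int poly \<Rightarrow> int poly fract)"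
  have R_sum: "sum f A \<in> R" if "\<And>i. i \<in> A \<Longrightarrow> f i \<in> R" for f and A :: "nat set"
    using that
  proof (induction A rule: infinite_finite_induct)
    case (insert a A)
    then obtain p p' where "f a = to_fract p" "sum f A = to_fract p'"
      unfolding R_def by blast
    then have "sum f (insert a A) = to_fract (p + p')"
      using insert by simp
    then show ?case
      unfolding R_def by blast
  qed (auto simp: R_def intro: range_eqI[of _ _ 0])
  have "fps_nth G n * to_fract (qpoch q_var q_var n) \<in> R"
  proof (cases "n = 0")
    case True
    then show ?thesis
      using F0 by (auto simp: G_def R_def intro: range_eqI[of _ _ 1])
  next
    case False
    have "0 = (\<Sum>i=0..n. fps_nth G i * fps_nth F (n - i))"
      using arg_cong[OF GF, of "\<lambda>f. fps_nth f n"] False by (simp add: fps_mult_nth)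
    also have "\<dots> = fps_nth G n + (\<Sum>i<n. fps_nth G i * fps_nth F (n - i))"
      using F0 by (simp add: atLeast0AtMost lessThan_Suc_atMost[symmetric] add.commute)
    finally have "fps_nth G n = (\<Sum>i<n. - (fps_nth G i * fps_nth F (n - i)))"
      by (simp add: sum_negf eq_neg_iff_add_eq_0)
    then have "fps_nth G n * to_fract (qpoch q_var q_var n)
        = (\<Sum>i<n. - (fps_nth G i * fps_nth F (n - i)) * to_fract (qpoch q_var q_var n))"
      by (simp only: sum_distrib_right)
    also have "\<dots> \<in> R"
    proof (rule R_sum)
      fix i assume "i \<in> {..<n}"
      then have i: "i < n" by simp
      obtain p where p: "to_fract p = fps_nth G i * to_fract (qpoch q_var q_var i)"
        using less[OF i] by (auto simp: G_def F_def)
      obtain c where c: "qpoch q_var q_var n = qpoch q_var q_var i * qpoch q_var q_var (n - i) * c"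
        using qpoch_mult_dvd[of q_var i "n - i"] i by (auto elim: dvdE)
      show "- (fps_nth G i * fps_nth F (n - i)) * to_fract (qpoch q_var q_var n) \<in> R"
      proof (cases "even (n - i)")
        case True
        have "- (fps_nth G i * fps_nth F (n - i)) * to_fract (qpoch q_var q_var n)
            = - (fps_nth G i * to_fract (qpoch q_var q_var i)) * to_fract c"
          using True by (simp add: c F_def q_even_series_def)
        also have "\<dots> = to_fract (- p * c)"
          by (simp add: p)
        finally show ?thesis
          unfolding R_def by blast
      next
        case False
        then have "fps_nth F (n - i) = 0"
          by (simp add: F_def q_even_series_def)
        then show ?thesis
          by (auto simp: R_def intro: range_eqI[of _ _ 0])
      qed
    qed
    finally show ?thesis .
  qed
  then show ?case
    unfolding R_def G_def F_def by (metis imageE)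
qed

lemma to_fract_q_euler:
  "to_fract (q_euler k) =
     fps_nth (inverse (q_even_series (\<lambda>_. 1))) k * to_fract (qpoch q_var q_var k)"
proof -
  have "\<exists>!p. to_fract p =
      fps_nth (inverse (q_even_series (\<lambda>_. 1))) k * to_fract (qpoch q_var q_var k)"
    using reciprocal_coeff_integral[of k] by (metis to_fract_eq_iff)
  then show ?thesis
    unfolding q_euler_def by (rule theI')
qed

lemma q_euler_odd:
  assumes "odd k"
  shows "q_euler k = 0"
  using assms
proof (induction k rule: less_induct)
  case (less k)
  define F where "F = q_even_series (\<lambda>_. 1)"
  define G where "G = inverse F"
  have F0: "fps_nth F 0 = 1"
    by (simp add: F_def q_even_series_def)
  have GF: "G * F = 1"
    using inverse_mult_eq_1[of F] F0 by (simp add: G_def)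
  have z: "fps_nth G i * fps_nth F (k - i) = 0" if "i < k" for i
  proof (cases "odd i")
    case True
    then have "q_euler i = 0"
      using less.IH that by blast
    then have "fps_nth G i = 0"
      using to_fract_q_euler[of i] by (simp add: G_def F_def)
    then show ?thesis by simp
  next
    case False
    then have "odd (k - i)"
      using less.prems that by simp
    then show ?thesis
      by (simp add: F_def q_even_series_def)
  qed
  have "k \<noteq> 0"
    using less.prems by (cases k) auto
  then have "0 = (\<Sum>i=0..k. fps_nth G i * fps_nth F (k - i))"
    using arg_cong[OF GF, of "\<lambda>f. fps_nth f k"] by (simp add: fps_mult_nth)
  also have "\<dots> = fps_nth G k"
  proof -
    have "(\<Sum>i<k. fps_nth G i * fps_nth F (k - i)) = 0"
      using z by (intro sum.neutral) blast
    then show ?thesis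
      using F0 by (simp add: atLeast0AtMost lessThan_Suc_atMost[symmetric])
  qed
  finally have "fps_nth G k = 0" by simp
  then have "to_fract (q_euler k) = 0"
    using to_fract_q_euler[of k] by (simp add: G_def F_def)
  then show ?case by simp
qed

theorem q_euler_generating_function:
  "q_even_series q_euler = inverse (q_even_series (\<lambda>_. 1))"
proof (rule fps_ext)
  fix k
  show "fps_nth (q_even_series q_euler) k = fps_nth (inverse (q_even_series (\<lambda>_. 1))) k"
  proof (cases "even k")
    case True
    then show ?thesis
      by (simp add: q_even_series_def[of q_euler] to_fract_q_euler)
  next
    case False
    then have "fps_nth (inverse (q_even_series (\<lambda>_. 1))) k = 0"
      using to_fract_q_euler[of k] q_euler_odd[of k] by simp
    then show ?thesis
      using False by (simp add: q_even_series_def[of q_euler])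
  qed
qed

end

theory Submission
  imports Defs "HOL-Analysis.Complex_Transcendental"
begin

text \<open>
  Since \<open>1 + q\<^sup>d\<close> is monic and squarefree, divisibility can be tested at the complex roots
  \<open>z\<close> of \<open>z\<^sup>d = -1\<close>.  If \<open>e\<close> is minimal with \<open>z\<^sup>e = -1\<close>, then \<open>z\<close> has order \<open>2e\<close>, and the
  \<open>q\<close>-Lucas property of the Gaussian binomials in the recurrence of the \<open>q\<close>-Euler numbers gives
  \<open>E\<^sub>2\<^sub>n\<^sub>+\<^sub>2\<^sub>e(z) = -E\<^sub>2\<^sub>n(z) = z\<^sup>e E\<^sub>2\<^sub>n(z)\<close>; as \<open>e\<close> divides \<open>d\<close>, this is the ``if'' direction.

  For the converse one may reduce \<open>m\<close> and \<open>n\<close> modulo \<open>d\<close>.  At \<open>z = cis (\<pi> / d)\<close> with \<open>d \<ge> 10\<close> the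
  leading term of the recurrence dominates the others, so that \<open>\<bar>E\<^sub>2\<^sub>n(z)\<bar>\<close> strictly increases for
  \<open>1 \<le> n < d\<close>, while the congruence would force two of these moduli to agree.  The estimate is too
  weak for \<open>d < 10\<close>; there the residues of \<open>E\<^sub>2\<^sub>n(3)\<close> modulo \<open>1 + 3\<^sup>d\<close> decide.
\<close>

subsection \<open>Gaussian binomials and the recurrence\<close>

text \<open>Gaussian binomials, given by the \<open>q\<close>-Pascal rule rather than as quotients:
  at roots of unity the denominators can vanish.\<close>

fun qbinom :: "'a::comm_ring_1 \<Rightarrow> nat \<Rightarrow> nat \<Rightarrow> 'a" where
  "qbinom q n 0 = 1"
| "qbinom q 0 (Suc k) = 0"
| "qbinom q (Suc n) (Suc k) = qbinom q n k + q ^ Suc k * qbinom q n (Suc k)"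

lemma qbinom_eq_0: "n < k \<Longrightarrow> qbinom q n k = 0"
  by (induction q n k rule: qbinom.induct) auto

lemma qbinom_self [simp]: "qbinom q n n = 1"
  by (induction n) (auto simp: qbinom_eq_0)

text \<open>Pascal's rule splits the left side, and
  \<open>1 - q ^ (i + j) = (1 - q ^ i) + q ^ i * (1 - q ^ j)\<close> reassembles it. The product
  form avoids division.\<close>

lemma qbinom_qpoch:
  "qbinom q (i + j) i * (qpoch q q i * qpoch q q j) = qpoch q q (i + j)"
proof (induction "i + j" arbitrary: i j)
  case 0
  then show ?case by simp
next
  case (Suc n)
  show ?case
  proof (cases i)
    case 0
    then show ?thesis by simp
  next
    case i: (Suc i')
    show ?thesis
    proof (cases j)
      case 0
      then show ?thesis by simp
    next
      case j: (Suc j')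
      have 1: "qbinom q n i' * (qpoch q q i' * qpoch q q j) = qpoch q q n"
        using Suc.hyps(1)[of i' j] Suc.hyps(2) i by simp
      have 2: "qbinom q n i * (qpoch q q i * qpoch q q j') = qpoch q q n"
        using Suc.hyps(1)[of i j'] Suc.hyps(2) i j by simp
      have n: "n = i' + j"
        using Suc.hyps(2) i by simp
      have "qbinom q (i + j) i * (qpoch q q i * qpoch q q j) =
            qbinom q n i' * (qpoch q q i' * qpoch q q j) * (1 - q ^ i)
            + q ^ i * (qbinom q n i * (qpoch q q i * qpoch q q j')) * (1 - q ^ j)"
        unfolding Suc.hyps(2)[symmetric] by (simp add: i j qpoch_Suc algebra_simps)
      also have "\<dots> = qpoch q q n * (1 - q ^ Suc n)"
        unfolding 1 2 by (simp add: n i algebra_simps power_add)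
      also have "\<dots> = qpoch q q (i + j)"
        unfolding Suc.hyps(2)[symmetric] by (simp add: qpoch_Suc)
      finally show ?thesis .
    qed
  qed
qed

text \<open>The index \<open>n\<close> stands for \<open>E_2n\<close>. Working over any commutative
  ring lets one recurrence serve polynomials, complex roots of unity and the integer 3.\<close>

fun q_euler_at :: "'a::comm_ring_1 \<Rightarrow> nat \<Rightarrow> 'a" where
  "q_euler_at q n =
     (if n = 0 then 1 else - (\<Sum>k<n. qbinom q (2 * n) (2 * k) * q_euler_at q k))"

declare q_euler_at.simps [simp del]

lemma q_euler_at_0 [simp]: "q_euler_at q 0 = 1"
  by (simp add: q_euler_at.simps)

lemma q_euler_at_Suc_0 [simp]: "q_euler_at q (Suc 0) = -1"
  by (simp add: q_euler_at.simps[of q "Suc 0"])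

lemma sum_qbinom_q_euler_at:
  "(\<Sum>k\<le>n. qbinom q (2 * n) (2 * k) * q_euler_at q k) = of_bool (n = 0)"
  by (cases "n = 0")
    (auto simp: q_euler_at.simps[of q n] lessThan_Suc_atMost[symmetric])

text \<open>The linear system is triangular with diagonal entries
  \<open>qbinom q (2 * n) (2 * n) = 1\<close>, so its solution is unique. Identities for
  \<open>q_euler_at\<close> are proved below by showing that both sides solve the same
  system.\<close>

lemma sum_qbinom_eq_iff:
  fixes f g :: "nat \<Rightarrow> 'a::comm_ring_1"
  assumes "\<And>n. (\<Sum>k\<le>n. qbinom q (2 * n) (2 * k) * f k) =
                (\<Sum>k\<le>n. qbinom q (2 * n) (2 * k) * g k)"
  shows "f n = g n"
proof (induction n rule: less_induct)
  case (less n)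
  have "(\<Sum>k<n. qbinom q (2 * n) (2 * k) * f k) = (\<Sum>k<n. qbinom q (2 * n) (2 * k) * g k)"
    using less by (intro sum.cong) auto
  with assms[of n] show ?case
    by (simp add: lessThan_Suc_atMost[symmetric])
qed

text \<open>The coefficient of \<open>x ^ (2 * n)\<close> in the product of the two reciprocal
  series, multiplied by \<open>P (2 * n)\<close>, is the defining recurrence; odd indices contribute
  nothing.\<close>

lemma q_euler_eq_q_euler_at: "q_euler (2 * n) = q_euler_at q_var n"
proof (rule sum_qbinom_eq_iff[where q = q_var and f = "\<lambda>n. q_euler (2 * n)"])
  fix n
  define P where "P k = qpoch q_var q_var k" for k
  have P: "to_fract (P k) \<noteq> 0" for k
    by (simp add: P_def)
  define F where "F = q_even_series (\<lambda>_. 1)"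
  have "fps_nth F 0 \<noteq> 0"
    by (simp add: F_def q_even_series_def)
  then have "q_even_series q_euler * F = 1"
    unfolding q_euler_generating_function F_def by (rule inverse_mult_eq_1)
  then have "of_bool (n = 0) = fps_nth (q_even_series q_euler * F) (2 * n)"
    by simp
  also have "\<dots> = (\<Sum>i\<le>2 * n. fps_nth (q_even_series q_euler) i * fps_nth F (2 * n - i))"
    by (simp add: fps_mult_nth atLeast0AtMost)
  also have "\<dots> = (\<Sum>i\<in>(\<lambda>k. 2 * k) ` {..n}.
      fps_nth (q_even_series q_euler) i * fps_nth F (2 * n - i))"
  proof (rule sum.mono_neutral_right)
    show "\<forall>i\<in>{..2 * n} - (*) 2 ` {..n}.
        fps_nth (q_even_series q_euler) i * fps_nth F (2 * n - i) = 0"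
      by (auto simp: q_even_series_def elim!: evenE)
  qed auto
  also have "\<dots> = (\<Sum>k\<le>n. to_fract (q_euler (2 * k)) / to_fract (P (2 * k))
      * (1 / to_fract (P (2 * (n - k)))))"
    by (subst sum.reindex) (auto simp: inj_on_def F_def q_even_series_def P_def diff_mult_distrib2)
  finally have "of_bool (n = 0) * to_fract (P (2 * n)) =
      (\<Sum>k\<le>n. to_fract (q_euler (2 * k)) / to_fract (P (2 * k))
        * (1 / to_fract (P (2 * (n - k)))) * to_fract (P (2 * n)))"
    by (simp add: sum_distrib_right)
  also have "\<dots> = (\<Sum>k\<le>n. to_fract (qbinom q_var (2 * n) (2 * k) * q_euler (2 * k)))"
  proof (rule sum.cong)
    fix k assume "k \<in> {..n}"
    then have "2 * n = 2 * k + 2 * (n - k)" by simp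
    then have "P (2 * n) = qbinom q_var (2 * n) (2 * k) * (P (2 * k) * P (2 * (n - k)))"
      unfolding P_def by (metis qbinom_qpoch)
    with P show "to_fract (q_euler (2 * k)) / to_fract (P (2 * k))
        * (1 / to_fract (P (2 * (n - k)))) * to_fract (P (2 * n))
      = to_fract (qbinom q_var (2 * n) (2 * k) * q_euler (2 * k))"
      by (simp add: field_simps)
  qed simp
  also have "\<dots> = to_fract (\<Sum>k\<le>n. qbinom q_var (2 * n) (2 * k) * q_euler (2 * k))"
    by (induction n) simp_all
  also have "of_bool (n = 0) * to_fract (P (2 * n)) = to_fract (of_bool (n = 0))"
    by (simp add: P_def)
  finally have "(\<Sum>k\<le>n. qbinom q_var (2 * n) (2 * k) * q_euler (2 * k)) = of_bool (n = 0)"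
    by (simp only: to_fract_eq_iff)
  then show "(\<Sum>k\<le>n. qbinom q_var (2 * n) (2 * k) * q_euler (2 * k)) =
      (\<Sum>k\<le>n. qbinom q_var (2 * n) (2 * k) * q_euler_at q_var k)"
    unfolding sum_qbinom_q_euler_at .
qed

section \<open>Ring homomorphisms and evaluation at complex numbers\<close>

lemma qbinom_hom:
  fixes h :: "'a::comm_ring_1 \<Rightarrow> 'b::comm_ring_1"
  assumes "h 0 = 0" "h 1 = 1" "\<And>x y. h (x + y) = h x + h y" "\<And>x y. h (x * y) = h x * h y"
  shows "h (qbinom q n k) = qbinom (h q) n k"
proof -
  have "h (q ^ k) = h q ^ k" for k
    by (induction k) (simp_all add: assms)
  then show ?thesis
    by (induction q n k rule: qbinom.induct) (simp_all add: assms)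
qed

text \<open>The image under \<open>h\<close> solves the system at \<open>h q\<close>, whose solution
  is unique. This is applied to \<open>ceval\<close> and to \<open>poly\<close>.\<close>

lemma q_euler_at_hom:
  fixes h :: "'a::comm_ring_1 \<Rightarrow> 'b::comm_ring_1"
  assumes h: "h 0 = 0" "h 1 = 1" "\<And>x y. h (x + y) = h x + h y" "\<And>x y. h (x * y) = h x * h y"
  shows "h (q_euler_at q n) = q_euler_at (h q) n"
proof (rule sum_qbinom_eq_iff[where q = "h q" and f = "\<lambda>n. h (q_euler_at q n)"])
  fix n
  have *: "h (sum f A) = (\<Sum>k\<in>A. h (f k))" for f and A :: "nat set"
    by (induction A rule: infinite_finite_induct) (simp_all add: h)
  have "(\<Sum>k\<le>n. qbinom (h q) (2 * n) (2 * k) * h (q_euler_at q k)) =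
      h (\<Sum>k\<le>n. qbinom q (2 * n) (2 * k) * q_euler_at q k)"
    by (simp only: * qbinom_hom[of h, OF h] h(4))
  also have "\<dots> = of_bool (n = 0)"
    unfolding sum_qbinom_q_euler_at by (simp add: h)
  finally show "(\<Sum>k\<le>n. qbinom (h q) (2 * n) (2 * k) * h (q_euler_at q k)) =
        (\<Sum>k\<le>n. qbinom (h q) (2 * n) (2 * k) * q_euler_at (h q) k)"
    by (simp only: sum_qbinom_q_euler_at)
qed

definition ceval :: "int poly \<Rightarrow> complex \<Rightarrow> complex" where
  "ceval p z = poly (map_poly of_int p) z"

lemma ceval_simps [simp]:
  "ceval 0 z = 0" "ceval 1 z = 1" "ceval q_var z = z"
  by (simp_all add: ceval_def map_poly_pCons)

lemma ceval_pCons: "ceval (pCons a p) z = of_int a + z * ceval p z"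
  by (simp add: ceval_def map_poly_pCons)

lemma ceval_add [simp]: "ceval (p + r) z = ceval p z + ceval r z"
  by (induction p r rule: poly_induct2) (simp_all add: ceval_pCons algebra_simps)

lemma ceval_smult [simp]: "ceval (smult a p) z = of_int a * ceval p z"
  by (induction p) (simp_all add: ceval_pCons algebra_simps)

lemma ceval_diff [simp]: "ceval (p - r) z = ceval p z - ceval r z"
  using ceval_add[of "p - r" r z] by simp

lemma ceval_mult [simp]: "ceval (p * r) z = ceval p z * ceval r z"
  by (induction p) (simp_all add: ceval_pCons algebra_simps)

lemma ceval_power [simp]: "ceval (p ^ n) z = ceval p z ^ n"
  by (induction n) simp_all

lemma ceval_q_euler_at [simp]: "ceval (q_euler_at p n) z = q_euler_at (ceval p z) n"
  by (rule q_euler_at_hom) simp_all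

section \<open>Shift rules at roots of unity\<close>

text \<open>The \<open>q\<close>-Lucas property for a shift by the exact order \<open>N\<close> of
  \<open>z\<close>. Pascal's rule carries it from \<open>n\<close> to \<open>Suc n\<close> because
  \<open>z ^ k = z ^ (k - N)\<close>.\<close>

lemma qbinom_add_order:
  fixes z :: complex
  assumes "0 < N" "z ^ N = 1" and prim: "\<And>j. 0 < j \<Longrightarrow> j < N \<Longrightarrow> z ^ j \<noteq> 1"
  shows "qbinom z (N + n) k = qbinom z n k + (if N \<le> k then qbinom z n (k - N) else 0)"
proof (induction n arbitrary: k)
  case 0
  have "qbinom z N k = 0" if "0 < k" "k < N"
  proof -
    \<comment> \<open>The product on the right contains the factor \<open>1 - z ^ N = 0\<close>,
      whereas the two on the left contain only \<open>1 - z ^ j\<close> with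
      \<open>0 < j < N\<close>.\<close>
    have "qbinom z N k * (qpoch z z k * qpoch z z (N - k)) = qpoch z z N"
      using qbinom_qpoch[of z k "N - k"] that by simp
    also have "\<dots> = 0"
      using assms(1,2) by (auto simp: qpoch_def intro!: bexI[of _ "N - 1"] simp flip: power_Suc)
    finally show ?thesis
      using prim that by (auto simp: qpoch_def simp flip: power_Suc)
  qed
  then show ?case
    using assms(1) by (cases k; cases "k = N") (auto simp: qbinom_eq_0)
next
  case (Suc n)
  show ?case
  proof (cases k)
    case 0
    with assms(1) show ?thesis by simp
  next
    case k: (Suc k')
    have r1: "qbinom z (N + Suc n) k = qbinom z (N + n) k' + z ^ k * qbinom z (N + n) k"
      and r2: "qbinom z (Suc n) k = qbinom z n k' + z ^ k * qbinom z n k"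
      by (simp_all add: k)
    consider "k < N" | "k = N" | "N < k" by linarith
    then show ?thesis
    proof cases
      case 1
      then show ?thesis using k unfolding r1 r2 Suc by simp
    next
      \<comment> \<open>Here \<open>k' = N - 1\<close> lies below \<open>N\<close>, so only the
        second Pascal term yields a shifted summand.\<close>
      case 2
      then have "\<not> N \<le> k'" "z ^ k = 1" "k - N = 0" "N \<le> k"
        using k assms(2) by auto
      then show ?thesis
        unfolding r1 r2 Suc by (simp del: diff_is_0_eq' diff_is_0_eq)
    next
      case 3
      then have "k - N = Suc (k' - N)" using k by simp
      moreover have zk: "z ^ k = z ^ (k - N)"
        using 3 assms(2) power_add[of z "k - N" N] by simp
      ultimately have "qbinom z (Suc n) (k - N) = qbinom z n (k' - N) + z ^ k * qbinom z n (k - N)"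
        by simp
      moreover have "N \<le> k'" "N \<le> k" using 3 k by auto
      ultimately show ?thesis
        unfolding r1 r2 Suc by (simp only: if_True distrib_left add_ac)
    qed
  qed
qed

text \<open>The order of \<open>z\<close> is \<open>2 * e\<close>, an even number, so the
  \<open>q\<close>-Lucas shift preserves the even indices of the recurrence. The recurrence at
  \<open>n + e\<close> then splits into the sums for \<open>q_euler_at z k\<close> and for
  \<open>q_euler_at z (k + e)\<close>, which cancel.\<close>

lemma q_euler_at_add_half_order:
  fixes z :: complex
  assumes "0 < e" "z ^ e = -1" and least: "\<And>j. 0 < j \<Longrightarrow> j < e \<Longrightarrow> z ^ j \<noteq> -1"
  shows "q_euler_at z (n + e) = - q_euler_at z n"
proof -
  have ord: "z ^ (2 * e) = 1"
    using assms(2) by (simp add: power_mult mult.commute[of 2])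
  have prim1: "z ^ j \<noteq> 1" if "0 < j" "j < e" for j
  proof
    assume "z ^ j = 1"
    then have "z ^ (e - j) = -1"
      using power_add[of z "e - j" j] that assms(2) by simp
    with least[of "e - j"] that show False by simp
  qed
  have prim: "z ^ j \<noteq> 1" if "0 < j" "j < 2 * e" for j
  proof
    assume j: "z ^ j = 1"
    have "j \<noteq> e" using j assms(2) by auto
    with prim1 that j have "e < j" by (metis nat_neq_iff)
    then have "z ^ (j - e) = -1"
      using power_add[of z "j - e" e] that assms(2) j by (simp add: minus_equation_iff)
    moreover have "0 < j - e" "j - e < e"
      using that \<open>e < j\<close> by linarith+
    ultimately show False using least by blast
  qed
  have luc: "qbinom z (2 * (n + e)) (2 * k) =
      qbinom z (2 * n) (2 * k) + (if e \<le> k then qbinom z (2 * n) (2 * (k - e)) else 0)" for n k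
    using qbinom_add_order[of "2 * e" z "2 * n" "2 * k"] assms(1) ord prim
    by (simp add: algebra_simps diff_mult_distrib2)
  show ?thesis
  proof (rule sum_qbinom_eq_iff[where q = z and f = "\<lambda>n. q_euler_at z (n + e)"
        and g = "\<lambda>n. - q_euler_at z n"])
    fix n
    \<comment> \<open>The right side of the recurrence is 0 even for \<open>n = 0\<close>, since
      \<open>n + e > 0\<close>.\<close>
    have "0 = (\<Sum>k\<le>n + e. qbinom z (2 * (n + e)) (2 * k) * q_euler_at z k)"
      using assms(1) by (simp only: sum_qbinom_q_euler_at) simp
    also have "\<dots> = (\<Sum>k\<le>n + e. qbinom z (2 * n) (2 * k) * q_euler_at z k) +
        (\<Sum>k\<le>n + e. (if e \<le> k then qbinom z (2 * n) (2 * (k - e)) else 0) * q_euler_at z k)"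
      by (simp only: luc distrib_right sum.distrib)
    also have "(\<Sum>k\<le>n + e. qbinom z (2 * n) (2 * k) * q_euler_at z k) =
        (\<Sum>k\<le>n. qbinom z (2 * n) (2 * k) * q_euler_at z k)"
      by (rule sum.mono_neutral_right) (auto simp: qbinom_eq_0)
    also have "(\<Sum>k\<le>n + e. (if e \<le> k then qbinom z (2 * n) (2 * (k - e)) else 0) * q_euler_at z k) =
        (\<Sum>k\<in>(\<lambda>k. k + e) ` {..n}. qbinom z (2 * n) (2 * (k - e)) * q_euler_at z k)"
    proof (rule sum.mono_neutral_cong_right)
      show "(\<lambda>k. k + e) ` {..n} \<subseteq> {..n + e}" by auto
      have "k \<in> (\<lambda>k. k + e) ` {..n}" if "e \<le> k" "k \<le> n + e" for k
        using that by (intro image_eqI[of _ _ "k - e"]) auto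
      then show "\<forall>i\<in>{..n + e} - (\<lambda>k. k + e) ` {..n}.
          (if e \<le> i then qbinom z (2 * n) (2 * (i - e)) else 0) * q_euler_at z i = 0"
        by auto
    qed auto
    also have "\<dots> = (\<Sum>k\<le>n. qbinom z (2 * n) (2 * k) * q_euler_at z (k + e))"
      by (subst sum.reindex) (auto simp: inj_on_def)
    finally show "(\<Sum>k\<le>n. qbinom z (2 * n) (2 * k) * q_euler_at z (k + e)) =
        (\<Sum>k\<le>n. qbinom z (2 * n) (2 * k) * - q_euler_at z k)"
      by (simp add: sum_negf eq_neg_iff_add_eq_0 add.commute)
  qed
qed

text \<open>The least \<open>e\<close> with \<open>z ^ e = -1\<close> divides \<open>d\<close> with
  odd quotient, so the sign changes of the single steps multiply to
  \<open>-1 = z ^ d\<close>.\<close>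

lemma q_euler_at_root_add:
  fixes z :: complex
  assumes "1 \<le> d" "z ^ d = -1"
  shows "q_euler_at z (n + d) = z ^ d * q_euler_at z n"
proof -
  define e where "e = (LEAST e. 0 < e \<and> z ^ e = -1)"
  have "0 < e \<and> z ^ e = -1"
    unfolding e_def by (rule LeastI[of _ d]) (use assms in simp)
  then have e: "0 < e" "z ^ e = -1" by auto
  have least: "z ^ j \<noteq> -1" if "0 < j" "j < e" for j
    using not_less_Least[of j "\<lambda>e. 0 < e \<and> z ^ e = -1"] that unfolding e_def by auto
  have step: "q_euler_at z (n + e * a) = (-1) ^ a * q_euler_at z n" for a
  proof (induction a)
    case (Suc a)
    have "q_euler_at z (n + e * Suc a) = - q_euler_at z (n + e * a)"
      using q_euler_at_add_half_order[OF e least, of "n + e * a"] by (simp add: algebra_simps)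
    with Suc show ?case by simp
  qed simp
  define a r where "a = d div e" and "r = d mod e"
  have d: "d = e * a + r" and "r < e"
    using e(1) by (simp_all add: a_def r_def)
  have zr: "(-1) ^ a * z ^ r = -1"
    using assms(2) e(2) by (simp add: d power_add power_mult)
  \<comment> \<open>For \<open>0 < r < e\<close>, either \<open>z ^ r = -1\<close> or
    \<open>z ^ (e - r) = -1\<close> would contradict the minimality of \<open>e\<close>.\<close>
  have "r = 0"
  proof (rule ccontr)
    assume r: "r \<noteq> 0"
    from zr have "z ^ r = 1 \<or> z ^ r = -1"
      by (cases "even a") auto
    then have "z ^ r = 1"
      using least[of r] r \<open>r < e\<close> by auto
    then have "z ^ (e - r) = -1"
      using power_add[of z "e - r" r] e(2) \<open>r < e\<close> by simp
    with least[of "e - r"] r \<open>r < e\<close> show False by simp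
  qed
  with zr have "(-1) ^ a = (-1 :: complex)" by simp
  with \<open>r = 0\<close> step[of a] d assms(2) show ?thesis by simp
qed

section \<open>Divisibility by \<open>1 + q ^ d\<close> tested at complex roots\<close>

text \<open>The remainder has degree below \<open>d\<close> but vanishes at the \<open>d\<close>
  distinct roots of \<open>z ^ d = -1\<close>, so it is zero.\<close>

lemma one_plus_power_dvd_iff:
  assumes "1 \<le> d"
  shows "(1 + q_var ^ d) dvd p \<longleftrightarrow> (\<forall>z. z ^ d = -1 \<longrightarrow> ceval p z = 0)"
proof
  assume "(1 + q_var ^ d) dvd p"
  then show "\<forall>z. z ^ d = -1 \<longrightarrow> ceval p z = 0"
    by (elim dvdE) simp
next
  assume roots: "\<forall>z. z ^ d = -1 \<longrightarrow> ceval p z = 0"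
  define D where "D = (1 + q_var ^ d :: int poly)"
  have qd: "q_var ^ d = monom 1 d"
    by (simp add: monom_altdef)
  have deg: "degree D = d"
    unfolding D_def qd using assms by (subst degree_add_eq_right) (simp_all add: degree_monom_eq)
  then have lead: "coeff D (degree D) = 1"
    using assms by (simp add: D_def qd)
  then have "D \<noteq> 0" by auto
  \<comment> \<open>For the monic \<open>D\<close>, pseudo-division is true division with remainder
    over the integers.\<close>
  obtain a r where ar: "pseudo_divmod p D = (a, r)"
    by (cases "pseudo_divmod p D")
  have p: "p = D * a + r" and r: "r = 0 \<or> degree r < d"
    using pseudo_divmod[OF \<open>D \<noteq> 0\<close> ar] lead deg by auto
  have "r = 0"
  proof (rule ccontr)
    assume "r \<noteq> 0"
    define R where "R = (map_poly of_int r :: complex poly)"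
    have "R \<noteq> 0"
      using \<open>r \<noteq> 0\<close> by (simp add: R_def map_poly_eq_0_iff)
    have "poly R z = 0" if "z ^ d = -1" for z
      using roots that by (simp add: p D_def R_def ceval_def[symmetric])
    then have "card {z :: complex. z ^ d = -1} \<le> card {z. poly R z = 0}"
      using \<open>R \<noteq> 0\<close> by (intro card_mono poly_roots_finite) auto
    also have "\<dots> \<le> degree R"
      using \<open>R \<noteq> 0\<close> by (rule card_poly_roots_bound)
    also have "\<dots> \<le> degree r"
      by (simp add: R_def degree_map_poly)
    also have "\<dots> < d" using r \<open>r \<noteq> 0\<close> by simp
    finally show False
      using card_nth_roots[of "-1" d] assms by simp
  qed
  then show "(1 + q_var ^ d) dvd p"
    using p by (simp add: D_def)
qed

text \<open>This is the "if" direction; it also reduces \<open>m\<close> and \<open>n\<close> modulo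
  \<open>d\<close> in the converse. Equality \<open>r = m\<close> is allowed because
  \<open>n\<close> may already lie below \<open>d\<close>.\<close>

lemma q_euler_at_cong:
  assumes "1 \<le> d" "r \<le> m" "[m = r] (mod d)"
  shows "(1 + q_var ^ d) dvd (q_euler_at q_var m - q_var ^ (m - r) * q_euler_at q_var r)"
proof -
  from assms obtain a where m: "m = r + a * d"
    by (metis cong_le_nat cong_sym_eq add.commute mult.commute)
  have "q_euler_at z (r + a * d) = z ^ (a * d) * q_euler_at z r" if "z ^ d = -1" for z :: complex
  proof (induction a)
    case (Suc a)
    then show ?case
      using q_euler_at_root_add[OF assms(1) that, of "r + a * d"]
      by (simp add: power_add algebra_simps)
  qed simp
  then show ?thesis
    by (simp add: one_plus_power_dvd_iff[OF assms(1)] m)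
qed

subsection \<open>Growth at a primitive root of unity\<close>

text \<open>Iterating the claim below \<open>n\<close> bounds \<open>G (n - j)\<close> by
  \<open>G (n - 1) / \<beta> ^ (j - 1)\<close>. The tail of the recurrence is then at most
  \<open>(1 - \<beta>) * G (n - 1)\<close>, which leaves \<open>\<beta> * G (n - 1)\<close> for the
  leading term.\<close>

lemma growth_from_recurrence:
  fixes G C :: "nat \<Rightarrow> real"
  assumes \<beta>: "0 < \<beta>"
    and C: "\<And>j. 2 \<le> j \<Longrightarrow> j < d \<Longrightarrow> 0 \<le> C j"
    and rec: "\<And>n. 1 \<le> n \<Longrightarrow> n < d \<Longrightarrow> G (n - 1) \<le> G n + (\<Sum>j=2..n. C j * G (n - j))"
    and G: "\<And>n. 0 \<le> G n"
    and small: "\<And>n. n < d \<Longrightarrow> (\<Sum>j=2..n. C j / \<beta> ^ (j - 1)) \<le> 1 - \<beta>"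
  shows "1 \<le> n \<Longrightarrow> n < d \<Longrightarrow> \<beta> * G (n - 1) \<le> G n"
proof (induction n rule: less_induct)
  case (less n)
  have iter: "\<beta> ^ i * G (n - 1 - i) \<le> G (n - 1)" if "i \<le> n - 1" for i
    using that
  proof (induction i)
    case (Suc i)
    have "\<beta> * G (n - 1 - i - 1) \<le> G (n - 1 - i)"
      using less.IH[of "n - 1 - i"] less.prems Suc.prems by simp
    then have "\<beta> ^ i * (\<beta> * G (n - 1 - i - 1)) \<le> \<beta> ^ i * G (n - 1 - i)"
      using \<beta> by (intro mult_left_mono) auto
    with Suc show ?case by (simp add: mult_ac)
  qed simp
  have "(\<Sum>j=2..n. C j * G (n - j)) \<le> (\<Sum>j=2..n. C j / \<beta> ^ (j - 1) * G (n - 1))"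
  proof (rule sum_mono)
    fix j assume j: "j \<in> {2..n}"
    then have "n - 1 - (j - 1) = n - j" by auto
    moreover have "j - 1 \<le> n - 1" using j by auto
    ultimately have "\<beta> ^ (j - 1) * G (n - j) \<le> G (n - 1)"
      using iter[of "j - 1"] by simp
    then have "G (n - j) \<le> G (n - 1) / \<beta> ^ (j - 1)"
      using \<beta> by (simp add: field_simps)
    then have "C j * G (n - j) \<le> C j * (G (n - 1) / \<beta> ^ (j - 1))"
      using C j less.prems by (intro mult_left_mono) auto
    then show "C j * G (n - j) \<le> C j / \<beta> ^ (j - 1) * G (n - 1)"
      by simp
  qed
  also have "\<dots> \<le> (1 - \<beta>) * G (n - 1)"
    unfolding sum_distrib_right[symmetric] using small less.prems G by (intro mult_right_mono) auto
  finally show ?case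
    using rec[of n] less.prems by (simp add: algebra_simps)
qed

text \<open>
  The last ratio \<open>C (d - 1) / C (d - 2)\<close> in the application is close to \<open>1/3\<close>, hence the weaker
  bound \<open>0.345\<close> beyond the fifth term; the sharper bound on the first terms is what makes the sum
  small enough.
\<close>

lemma coefficient_sum_le:
  fixes C :: "nat \<Rightarrow> real"
  assumes d: "10 \<le> d"
    and C0: "\<And>j. 2 \<le> j \<Longrightarrow> j < d \<Longrightarrow> 0 \<le> C j"
    and C2: "C 2 \<le> 0.1815"
    and T: "\<And>j. 2 \<le> j \<Longrightarrow> j \<le> 4 \<Longrightarrow> C (Suc j) \<le> 0.1167 * C j"
    and \<tau>: "\<And>j. 5 \<le> j \<Longrightarrow> Suc j < d \<Longrightarrow> C (Suc j) \<le> 0.345 * C j"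
    and n: "n < d"
  shows "(\<Sum>j=2..n. C j / 0.65 ^ (j - 1)) \<le> 1 - 0.65"
proof -
  define h where "h j = C j / 0.65 ^ (j - 1)" for j
  have h0: "0 \<le> h j" if "2 \<le> j" "j < d" for j
    using C0 that by (simp add: h_def)
  have hS: "h (Suc j) \<le> c / 0.65 * h j" if "C (Suc j) \<le> c * C j" "1 \<le> j" for j c
  proof -
    have "C (Suc j) / 0.65 ^ j \<le> c * C j / 0.65 ^ j"
      using that by (intro divide_right_mono) auto
    moreover have "(0.65::real) ^ j = 0.65 * 0.65 ^ (j - 1)"
      using that by (cases j) auto
    ultimately show ?thesis by (simp add: h_def field_simps)
  qed
  have h2: "h 2 \<le> 0.1815 / 0.65"
    using C2 by (simp add: h_def)
  have h3: "h 3 \<le> 0.1167 / 0.65 * h 2"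
    using hS[OF T, of 2] by (simp add: eval_nat_numeral)
  have h4: "h 4 \<le> 0.1167 / 0.65 * h 3"
    using hS[OF T, of 3] by (simp add: eval_nat_numeral)
  have h5: "h 5 \<le> 0.1167 / 0.65 * h 4"
    using hS[OF T, of 4] by (simp add: eval_nat_numeral)
  have hr: "h (Suc j) \<le> 0.345 / 0.65 * h j" if "5 \<le> j" "Suc j < d" for j
    using hS[OF \<tau>[OF that]] that by simp
  \<comment> \<open>Extending the sum to at least five only adds nonnegative terms and gives the
    geometric estimate a fixed starting point.\<close>
  define N where "N = max n 5"
  have N: "5 \<le> N" "N < d" "n \<le> N" using n d by (auto simp: N_def)
  \<comment> \<open>With the ratio \<open>\<rho> = 0.345 / 0.65\<close>, the constants are
    \<open>\<rho> / (1 - \<rho>) = 0.345 / 0.305\<close> and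
    \<open>1 / (1 - \<rho>) = 0.65 / 0.305\<close>. The extra summand on the left stands for the
    geometric tail after \<open>N\<close> and makes the bound inductive.\<close>
  have geo: "(\<Sum>j=2..N. h j) + h N * (0.345 / 0.305) \<le> h 2 + h 3 + h 4 + h 5 * (0.65 / 0.305)"
    using N(1,2)
  proof (induction N rule: dec_induct)
    case base
    have "{2..5::nat} = {2, 3, 4, 5}" by auto
    then show ?case by (simp add: field_simps)
  next
    case (step k)
    have "h (Suc k) * (0.65 / 0.305) \<le> h k * (0.345 / 0.305)"
      using hr[of k] step by simp
    moreover have "(\<Sum>j=2..Suc k. h j) = (\<Sum>j=2..k. h j) + h (Suc k)"
      using step by simp
    ultimately show ?case using step by (simp add: field_simps)
  qed
  have "(\<Sum>j=2..n. h j) \<le> (\<Sum>j=2..N. h j)"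
    using N h0 by (intro sum_mono2) auto
  moreover have "0 \<le> h N" using h0 N by simp
  ultimately have "(\<Sum>j=2..n. h j) \<le> 1 - 0.65"
    using geo h2 h3 h4 h5 by (simp add: field_simps)
  then show ?thesis by (simp add: h_def)
qed

section \<open>Sine estimates\<close>

lemma norm_one_minus_cis: "norm (1 - cis (2 * x)) = 2 * \<bar>sin x\<bar>"
proof -
  have "(norm (1 - cis (2 * x)))\<^sup>2 = (1 - cos (2 * x))\<^sup>2 + (sin (2 * x))\<^sup>2"
    by (simp add: cmod_power2)
  also have "\<dots> = (2 * \<bar>sin x\<bar>)\<^sup>2"
    using sin_cos_squared_add[of x] unfolding cos_double_sin sin_double power2_abs power_mult_distrib
    by algebra
  finally show ?thesis
    by (rule power2_eq_imp_eq) simp_all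
qed

lemma sin_ge_of_symmetric_range:
  fixes a t :: real
  assumes "0 \<le> a" "a \<le> t" "t \<le> pi - a"
  shows "sin a \<le> sin t"
proof (cases "t \<le> pi / 2")
  case True
  then show ?thesis using assms by (intro sin_monotone_2pi_le) auto
next
  case False
  then have "sin a \<le> sin (pi - t)" using assms by (intro sin_monotone_2pi_le) auto
  then show ?thesis by simp
qed

text \<open>After division by common sines, each bound concerns a polynomial in
  \<open>u = (cos x)\<^sup>2\<close>, with \<open>u \<ge> 0.975\<close> on this range. The constants
  are the reciprocals of 5.51, 8.569 and 2.9, the values at \<open>u = 0.975\<close>, rounded
  up.\<close>

lemma sine_ratio_bounds:
  fixes x :: real
  assumes "0 < x" "x \<le> pi / 20"
  shows "sin x * sin (2 * x) \<le> 0.1815 * (sin (3 * x) * sin (4 * x))"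
    and "sin x * sin (2 * x) \<le> 0.1167 * (sin (4 * x) * sin (5 * x))"
    and "sin x * sin (2 * x) \<le> 0.345 * (sin (2 * x) * sin (3 * x))"
proof -
  define u where "u = (cos x)\<^sup>2"
  have "sin x \<le> 0.15708"
    using sin_x_le_x[of x] assms pi_approx by simp
  moreover have s: "0 < sin x" using assms by (intro sin_gt_zero) auto
  ultimately have "(sin x)\<^sup>2 \<le> 0.15708\<^sup>2" by (intro power_mono) auto
  then have u: "0.975 \<le> u" "u \<le> 1"
    using sin_cos_squared_add[of x] by (auto simp: u_def cos_squared_eq power2_eq_square[of "_ / _"])
  have sx: "(sin x)\<^sup>2 = 1 - u" by (simp add: u_def sin_squared_eq)
  have c: "0 < cos x" using assms by (intro cos_gt_zero_pi) auto
  have s2: "sin (2 * x) = 2 * sin x * cos x" by (rule sin_double)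
  have c2: "cos (2 * x) = 2 * u - 1" by (simp add: cos_double_cos u_def)
  have s3: "sin (3 * x) = sin x * (4 * u - 1)"
    using sin_add[of "2 * x" x] unfolding s2 c2 by (simp add: u_def power2_eq_square algebra_simps)
  have c3: "cos (3 * x) = cos x * (4 * u - 3)"
  proof -
    have "cos (3 * x) = (2 * u - 1) * cos x - 2 * (sin x)\<^sup>2 * cos x"
      using cos_add[of "2 * x" x] unfolding s2 c2 by (simp add: power2_eq_square algebra_simps)
    then show ?thesis unfolding sx by (simp add: algebra_simps)
  qed
  have s4: "sin (4 * x) = sin (2 * x) * (2 * (2 * u - 1))"
    using sin_double[of "2 * x"] by (simp add: c2)
  have s5: "sin (5 * x) = sin x * (16 * u\<^sup>2 - 12 * u + 1)"
    using sin_add[of "2 * x" "3 * x"] unfolding s2 c2 s3 c3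
    by (simp add: u_def power2_eq_square algebra_simps)
  have p: "0 \<le> sin x * sin (2 * x)" using s c by (simp add: s2)
  have "0.1815 * ((4 * u - 1) * (2 * (2 * u - 1))) \<ge> 1"
  proof -
    have "2.9 * 1.9 \<le> (4 * u - 1) * (2 * (2 * u - 1))" using u by (intro mult_mono) auto
    then show ?thesis by simp
  qed
  from mult_right_mono[OF this p]
  show "sin x * sin (2 * x) \<le> 0.1815 * (sin (3 * x) * sin (4 * x))"
    unfolding s4 s3 by (simp only: mult_ac mult_1)
  have "0.1167 * ((2 * (2 * u - 1)) * (16 * u\<^sup>2 - 12 * u + 1)) \<ge> 1"
  proof -
    \<comment> \<open>The product equals \<open>16 * u\<^sup>2 - 12 * u + 1 - 4.51\<close>.\<close>
    have "0 \<le> (u - 0.975) * (16 * u + 3.6)" using u by (intro mult_nonneg_nonneg) auto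
    then have "4.51 \<le> 16 * u\<^sup>2 - 12 * u + 1" by (simp add: power2_eq_square algebra_simps)
    then have "1.9 * 4.51 \<le> (2 * (2 * u - 1)) * (16 * u\<^sup>2 - 12 * u + 1)" using u by (intro mult_mono) auto
    then show ?thesis by simp
  qed
  from mult_right_mono[OF this p]
  show "sin x * sin (2 * x) \<le> 0.1167 * (sin (4 * x) * sin (5 * x))"
    unfolding s4 s5 by (simp only: mult_ac mult_1)
  have "0.345 * (4 * u - 1) \<ge> 1" using u by simp
  from mult_right_mono[OF this p]
  show "sin x * sin (2 * x) \<le> 0.345 * (sin (2 * x) * sin (3 * x))"
    unfolding s3 by (simp only: mult_ac mult_1)
qed

text \<open>The weights \<open>C\<close> turn the recurrence into a convolution for
  \<open>G k = E k * C k\<close>. In one step \<open>G\<close> keeps at least the factor 0.65 while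
  \<open>C\<close> drops to at most 0.345 of its value, so \<open>E\<close> must grow. The start is
  \<open>n = 1\<close> because the values at 0 and 1 both have modulus 1.\<close>

lemma norm_q_euler_at_less_Suc:
  assumes d: "10 \<le> d" and n: "1 \<le> n" "Suc n < d"
  shows "norm (q_euler_at (cis (pi / d)) n) < norm (q_euler_at (cis (pi / d)) (Suc n))"
proof -
  \<comment> \<open>Half the argument of \<open>z\<close>, so that the chord
    \<open>norm (1 - z ^ k)\<close> is \<open>2 * s k\<close> for
    \<open>0 < k < 2 * d\<close>.\<close>
  define x where "x = pi / (2 * d)"
  define z where "z = cis (pi / d)"
  define s where "s k = sin (k * x)" for k :: nat
  have x: "0 < x" "x \<le> pi / 20"
    using d by (auto simp: x_def field_simps)
  have s_ge: "s a \<le> s k" if "a \<le> k" "k + a \<le> 2 * d" for a k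
    unfolding s_def
  proof (rule sin_ge_of_symmetric_range)
    have "real (k + a) * x \<le> real (2 * d) * x"
      using that(2) x(1) by (intro mult_right_mono) auto
    also have "\<dots> = pi" using d by (simp add: x_def)
    finally show "real k * x \<le> pi - real a * x" by (simp add: algebra_simps)
  qed (use that(1) x(1) in auto)
  have s1: "0 < s 1"
    using x by (auto simp: s_def intro!: sin_gt_zero)
  have s_pos: "0 < s k" if "1 \<le> k" "k < 2 * d" for k
    using s_ge[of 1 k] s1 that by simp
  have norm_pow: "norm (1 - z * z ^ k) = 2 * s (Suc k)" if "Suc k < 2 * d" for k
  proof -
    have "z * z ^ k = cis (real (Suc k) * (pi / d))"
      unfolding z_def using Complex.DeMoivre[of "pi / d" "Suc k"] by simp
    also have "\<dots> = cis (2 * (Suc k * x))"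
      by (simp add: x_def)
    finally have "z * z ^ k = cis (2 * (Suc k * x))" .
    then show ?thesis
      using s_pos[of "Suc k"] that unfolding s_def by (simp add: norm_one_minus_cis)
  qed
  define w where "w k = qpoch z z (2 * k)" for k
  have w_0: "w 0 = 1" by (simp add: w_def)
  have w_Suc: "norm (w (Suc k)) = norm (w k) * (4 * s (2 * k + 1) * s (2 * k + 2))"
    if "k + 1 < d" for k
    using norm_pow[of "2 * k"] norm_pow[of "2 * k + 1"] that by (simp add: w_def qpoch_Suc norm_mult)
  have w_pos: "0 < norm (w k)" if "k < d" for k
    using that
  proof (induction k)
    case (Suc k)
    then show ?case
      using s_pos[of "2 * k + 1"] s_pos[of "2 * k + 2"] by (simp only: w_Suc) simp
  qed (simp add: w_0)
  \<comment> \<open>This is the modulus of \<open>qpoch z z 2\<close>, chosen so that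
    \<open>C 1 = 1\<close>.\<close>
  define A where "A = 4 * s 1 * s 2"
  have A: "0 < A" using s_pos[of 1] s_pos[of 2] d by (simp add: A_def)
  define C where "C j = A ^ j / norm (w j)" for j
  define E where "E k = norm (q_euler_at z k)" for k
  define G where "G k = E k * C k" for k
  have C_pos: "0 < C j" if "j < d" for j
    using that A w_pos by (simp add: C_def)
  have C_0: "C 0 = 1" by (simp add: C_def w_0)
  have C_Suc: "C (Suc j) \<le> c * C j"
    if "Suc j < d" "s 1 * s 2 \<le> c * (s (2 * j + 1) * s (2 * j + 2))" for j c
  proof -
    have "s 1 * s 2 / (s (2 * j + 1) * s (2 * j + 2)) \<le> c"
      using that s_pos[of "2 * j + 1"] s_pos[of "2 * j + 2"] by (simp add: field_simps)
    then have "s 1 * s 2 / (s (2 * j + 1) * s (2 * j + 2)) * C j \<le> c * C j"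
      using C_pos[of j] that by (intro mult_right_mono) auto
    moreover have "C (Suc j) = s 1 * s 2 / (s (2 * j + 1) * s (2 * j + 2)) * C j"
      using that(1) by (simp add: C_def w_Suc A_def mult_ac)
    ultimately show ?thesis by simp
  qed
  have C_1: "C 1 = 1"
    using A w_Suc[of 0] d by (auto simp: C_def w_0 A_def numeral_2_eq_2)
  note ratios = sine_ratio_bounds[OF x]
  have C_2: "C 2 \<le> 0.1815"
    using C_Suc[of 1 "0.1815"] C_1 d ratios(1) by (simp add: s_def eval_nat_numeral)
  have \<tau>: "C (Suc j) \<le> 0.345 * C j" if "1 \<le> j" "Suc j < d" for j
  proof (rule C_Suc[OF that(2)])
    \<comment> \<open>The sine is symmetric about the index \<open>d\<close>; the worst case is
      \<open>j = d - 2\<close>, where both bounds are equalities.\<close>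
    have "s 3 \<le> s (2 * j + 1)" "s 2 \<le> s (2 * j + 2)"
      using that by (auto intro!: s_ge)
    then have "s 2 * s 3 \<le> s (2 * j + 2) * s (2 * j + 1)"
      using s_pos[of 2] s_pos[of 3] d by (intro mult_mono) auto
    then show "s 1 * s 2 \<le> 0.345 * (s (2 * j + 1) * s (2 * j + 2))"
      using ratios(3) by (simp add: s_def mult_ac)
  qed
  have T: "C (Suc j) \<le> 0.1167 * C j" if "2 \<le> j" "j \<le> 4" for j
  proof (rule C_Suc)
    have "s 5 \<le> s (2 * j + 1)" "s 4 \<le> s (2 * j + 2)"
      using that d by (auto intro!: s_ge)
    then have "s 4 * s 5 \<le> s (2 * j + 2) * s (2 * j + 1)"
      using s_pos[of 4] s_pos[of 5] d by (intro mult_mono) auto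
    then show "s 1 * s 2 \<le> 0.1167 * (s (2 * j + 1) * s (2 * j + 2))"
      using ratios(2) by (simp add: s_def mult_ac)
  qed (use that d in simp)
  have "0.65 * G (m - 1) \<le> G m" if m: "1 \<le> m" "m < d" for m
  proof (rule growth_from_recurrence[OF _ _ _ _ _ m])
    show "(\<Sum>j=2..n. C j / 0.65 ^ (j - 1)) \<le> 1 - 0.65" if "n < d" for n
      using d C_pos C_2 T \<tau> that by (intro coefficient_sum_le[where d = d]) (auto simp: less_imp_le)
    show "0 \<le> C j" if "j < d" for j using C_pos that by (simp add: less_imp_le)
    show "0 \<le> G n" for n
      using A by (simp add: G_def E_def C_def)
  next
    fix n assume n: "1 \<le> n" "n < d"
    \<comment> \<open>The powers of \<open>A\<close> cancel, because \<open>k\<close> and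
      \<open>n - k\<close> add up to \<open>n\<close>.\<close>
    have norm_qbinom: "norm (qbinom z (2 * n) (2 * k)) = C k * C (n - k) / C n" if "k \<le> n" for k
    proof -
      have "qbinom z (2 * n) (2 * k) * (w k * w (n - k)) = w n"
        using qbinom_qpoch[of z "2 * k" "2 * (n - k)"] that
        by (simp add: w_def diff_mult_distrib2)
      then have "norm (qbinom z (2 * n) (2 * k)) * (norm (w k) * norm (w (n - k))) = norm (w n)"
        by (metis norm_mult)
      moreover have "A ^ n = A ^ k * A ^ (n - k)"
        using that by (simp flip: power_add)
      ultimately show ?thesis
        using w_pos[of k] w_pos[of "n - k"] w_pos[of n] n that A
        by (simp add: C_def field_simps)
    qed
    define f where "f k = qbinom z (2 * n) (2 * k) * q_euler_at z k" for k
    have f: "norm (f k) = C (n - k) * G k / C n" if "k \<le> n" for k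
      using norm_qbinom[OF that] by (simp add: f_def norm_mult G_def E_def)
    have "0 = (\<Sum>k\<le>n. f k)"
      using sum_qbinom_q_euler_at[of z n] n by (simp add: f_def)
    also have "\<dots> = f n + (\<Sum>k<n. f k)"
      by (simp add: lessThan_Suc_atMost[symmetric])
    also have "(\<Sum>k<n. f k) = f (n - 1) + (\<Sum>k<n - 1. f k)"
      using n by (cases n) simp_all
    \<comment> \<open>The recurrence is solved for the term at \<open>n - 1\<close>, the one that
      dominates the earlier terms, before the triangle inequality is applied.\<close>
    finally have "f (n - 1) = - (f n + (\<Sum>k<n - 1. f k))"
      by (simp only: eq_neg_iff_add_eq_0 add_ac)
    then have "norm (f (n - 1)) \<le> norm (f n) + norm (\<Sum>k<n - 1. f k)"
      by (simp only: norm_minus_cancel norm_triangle_ineq)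
    also have "norm (\<Sum>k<n - 1. f k) \<le> (\<Sum>k<n - 1. norm (f k))"
      by (rule norm_sum)
    also have "\<dots> = (\<Sum>k<n - 1. C (n - k) * G k / C n)"
      by (intro sum.cong) (auto simp: f)
    also have "\<dots> = (\<Sum>j=2..n. C j * G (n - j) / C n)"
      using n by (intro sum.reindex_bij_witness[of _ "\<lambda>j. n - j" "\<lambda>k. n - k"]) auto
    finally have "C 1 * G (n - 1) / C n \<le> C 0 * G n / C n + (\<Sum>j=2..n. C j * G (n - j) / C n)"
      using n by (simp add: f)
    then have "G (n - 1) / C n \<le> (G n + (\<Sum>j=2..n. C j * G (n - j))) / C n"
      by (simp only: C_0 C_1 mult_1 add_divide_distrib sum_divide_distrib)
    then show "G (n - 1) \<le> G n + (\<Sum>j=2..n. C j * G (n - j))"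
      using C_pos[OF n(2)] by (simp add: divide_le_cancel)
  qed simp_all
  then have le: "0.65 * E m \<le> 0.345 * E (Suc m)" if "1 \<le> m" "Suc m < d" for m
  proof -
    have "0.65 * E m * C m \<le> E (Suc m) * C (Suc m)"
      using that \<open>\<And>m. 1 \<le> m \<Longrightarrow> m < d \<Longrightarrow> 0.65 * G (m - 1) \<le> G m\<close>[of "Suc m"]
      by (simp add: G_def)
    also have "\<dots> \<le> E (Suc m) * (0.345 * C m)"
      using \<tau>[OF that] by (intro mult_left_mono) (auto simp: E_def)
    finally have "0.65 * E m * C m \<le> 0.345 * E (Suc m) * C m" by simp
    then show ?thesis
      using C_pos[of m] that by simp
  qed
  have "0 < E m" if "1 \<le> m" "m < d" for m
    using that
  proof (induction m rule: dec_induct)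
    case base
    show ?case by (simp add: E_def)
  next
    case (step m)
    then show ?case using le[of m] by simp
  qed
  from this[of n] le[of n] n have "E n < E (Suc n)" by simp
  then show ?thesis by (simp add: E_def z_def)
qed

subsection \<open>Small moduli\<close>

lemma poly_q_euler_at: "poly (q_euler_at p n) z = q_euler_at (poly p z) n"
  by (rule q_euler_at_hom) simp_all

lemma qpoch_nonzero_int:
  assumes "2 \<le> (a :: int)"
  shows "qpoch a a n \<noteq> 0"
proof -
  have "1 < a ^ Suc k" for k using assms by (intro one_less_power) auto
  then have "1 - a * a ^ k \<noteq> 0" for k by (simp add: less_imp_neq)
  then show ?thesis by (simp add: qpoch_def)
qed

text \<open>An evaluable form for explicit integers: products and exact division replace the
  branching Pascal recursion. For \<open>a \<ge> 2\<close> the denominators are nonzero.\<close>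

lemma q_euler_at_int:
  assumes "2 \<le> (a :: int)" "0 < n"
  shows "q_euler_at a n = - (\<Sum>k<n. qpoch a a (2 * n) div (qpoch a a (2 * k) * qpoch a a (2 * (n - k)))
           * q_euler_at a k)"
proof -
  have "qbinom a (2 * n) (2 * k) = qpoch a a (2 * n) div (qpoch a a (2 * k) * qpoch a a (2 * (n - k)))"
    if "k < n" for k
  proof -
    have "qpoch a a (2 * n) =
        qbinom a (2 * n) (2 * k) * (qpoch a a (2 * k) * qpoch a a (2 * (n - k)))"
      using qbinom_qpoch[of a "2 * k" "2 * (n - k)"] that by (simp add: diff_mult_distrib2)
    then show ?thesis
      using qpoch_nonzero_int[OF assms(1)] by simp
  qed
  then have "(\<Sum>k<n. qbinom a (2 * n) (2 * k) * q_euler_at a k) =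
      (\<Sum>k<n. qpoch a a (2 * n) div (qpoch a a (2 * k) * qpoch a a (2 * (n - k))) * q_euler_at a k)"
    by (intro sum.cong) simp_all
  with q_euler_at.simps[of a n] assms(2) show ?thesis by simp
qed

lemma q_euler_at_3:
  "q_euler_at (3::int) 2 = 129"
  "q_euler_at (3::int) 3 = -1409409"
  "q_euler_at (3::int) 4 = 1253405000961"
  "q_euler_at (3::int) 5 = -90337117144458694401"
  "q_euler_at (3::int) 6 = 527414664652491714233203795329"
  "q_euler_at (3::int) 7 = -249417027745281120459281526695035454115969"
  "q_euler_at (3::int) 8 = 9554002259715231148583306420128435019179354544176601601"
proof -
  note eval = q_euler_at_int[of 3] qpoch_def lessThan_nat_numeral lessThan_Suc
  show 2: "q_euler_at (3::int) 2 = 129" by (simp add: eval)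
  show 3: "q_euler_at (3::int) 3 = -1409409" by (simp add: eval 2)
  show 4: "q_euler_at (3::int) 4 = 1253405000961" by (simp add: eval 2 3)
  show 5: "q_euler_at (3::int) 5 = -90337117144458694401" by (simp add: eval 2 3 4)
  show 6: "q_euler_at (3::int) 6 = 527414664652491714233203795329" by (simp add: eval 2 3 4 5)
  show 7: "q_euler_at (3::int) 7 = -249417027745281120459281526695035454115969"
    by (simp add: eval 2 3 4 5 6)
  show "q_euler_at (3::int) 8 = 9554002259715231148583306420128435019179354544176601601"
    by (simp add: eval 2 3 4 5 6 7)
qed

text \<open>The factor \<open>3 ^ (9 - r)\<close> brings all indices to a common scale, so that one
  list decides every pair \<open>r < s\<close>. The exponent 9 exceeds each index
  \<open>r < d\<close>.\<close>

lemma distinct_residues_at_3: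
  assumes "d \<in> {2..9}"
  shows "distinct (map (\<lambda>r. 3 ^ (9 - r) * q_euler_at (3::int) r mod (1 + 3 ^ d)) [0..<d])"
proof -
  have "d \<in> {2, 3, 4, 5, 6, 7, 8, 9}" using assms by auto
  then show ?thesis
    by (elim insertE emptyE; hypsubst) 
      (simp_all add: q_euler_at_3 upt_rec[of 0] upt_rec[of "Suc 0", folded numeral_2_eq_2])
qed

lemma not_dvd_at_3:
  assumes "r < s" "s < d" "d < 10"
  shows "\<not> (1 + 3 ^ d) dvd (q_euler_at (3::int) s - 3 ^ (s - r) * q_euler_at 3 r)"
proof
  assume "(1 + 3 ^ d) dvd (q_euler_at (3::int) s - 3 ^ (s - r) * q_euler_at 3 r)"
  then have "(1 + 3 ^ d) dvd 3 ^ (9 - s) * (q_euler_at (3::int) s - 3 ^ (s - r) * q_euler_at 3 r)"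
    by (rule dvd_mult)
  also have "\<dots> = 3 ^ (9 - s) * q_euler_at 3 s - 3 ^ (9 - r) * q_euler_at 3 r"
    using assms by (simp add: right_diff_distrib flip: mult.assoc power_add)
  finally have "3 ^ (9 - s) * q_euler_at (3::int) s mod (1 + 3 ^ d) =
      3 ^ (9 - r) * q_euler_at 3 r mod (1 + 3 ^ d)"
    by (simp add: mod_eq_dvd_iff)
  moreover have "d \<in> {2..9}" using assms by auto
  ultimately show False
    using distinct_residues_at_3[of d] assms by (auto simp: distinct_conv_nth)
qed

subsection \<open>Distinct residues\<close>

text \<open>Since \<open>z\<close> has modulus 1, divisibility would make the two moduli equal,
  against strict growth from index 1 on. Index 0 is compared through index 1, which has the same
  modulus; the remaining pair 0, 1 would force \<open>z = -1\<close>.\<close>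

lemma not_dvd_large:
  assumes rs: "r < s" "s < d" and d: "10 \<le> d"
  shows "\<not> (1 + q_var ^ d) dvd (q_euler_at q_var s - q_var ^ (s - r) * q_euler_at q_var r)"
proof
  assume dvd: "(1 + q_var ^ d) dvd (q_euler_at q_var s - q_var ^ (s - r) * q_euler_at q_var r)"
  define z where "z = cis (pi / d)"
  have "z ^ d = -1" using d by (simp add: z_def Complex.DeMoivre)
  then have eq: "q_euler_at z s = z ^ (s - r) * q_euler_at z r"
    using dvd d by (simp add: one_plus_power_dvd_iff)
  then have norm_eq: "norm (q_euler_at z s) = norm (q_euler_at z r)"
    by (simp add: norm_mult norm_power z_def)
  have mono: "norm (q_euler_at z a) < norm (q_euler_at z b)" if "1 \<le> a" "a < b" "b < d" for a b
    using that(2,3)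
  proof (induction b)
    case (Suc b)
    then have "norm (q_euler_at z b) < norm (q_euler_at z (Suc b))"
      using norm_q_euler_at_less_Suc[of d b] d that(1) by (simp add: z_def)
    with Suc show ?case by (cases "a = b") auto
  qed simp
  have e1: "q_euler_at z 1 = -1"
    by simp
  show False
  proof (cases "r = 0")
    case False
    with mono[of r s] rs norm_eq show False by simp
  next
    case True
    show False
    proof (cases "s = 1")
      case True
      with eq \<open>r = 0\<close> e1 have "z = -1" by simp
      moreover have "0 < sin (pi / d)" using d by (intro sin_gt_zero) (auto simp: field_simps)
      ultimately show False by (simp add: z_def complex_eq_iff)
    next
      case False
      with mono[of 1 s] rs norm_eq e1 True show False by simp
    qed
  qed
qed

lemma not_dvd_of_distinct_residues:
  assumes rs: "r < s" "s < d"
  shows "\<not> (1 + q_var ^ d) dvd (q_euler_at q_var s - q_var ^ (s - r) * q_euler_at q_var r)"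
proof (cases "10 \<le> d")
  case True
  with not_dvd_large rs show ?thesis by blast
next
  case False
  show ?thesis
  proof
    assume "(1 + q_var ^ d) dvd (q_euler_at q_var s - q_var ^ (s - r) * q_euler_at q_var r)"
    then obtain p where "q_euler_at q_var s - q_var ^ (s - r) * q_euler_at q_var r = (1 + q_var ^ d) * p"
      by (elim dvdE)
    \<comment> \<open>Polynomial divisibility survives evaluation, so failure at 3 suffices.\<close>
    from arg_cong[OF this, of "\<lambda>p. poly p 3"]
    have "q_euler_at 3 s - 3 ^ (s - r) * q_euler_at 3 r = (1 + 3 ^ d) * poly p 3"
      by (simp add: poly_q_euler_at)
    then have "(1 + 3 ^ d) dvd (q_euler_at (3::int) s - 3 ^ (s - r) * q_euler_at 3 r)"
      by simp
    with not_dvd_at_3[of r s d] rs False show False by simp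
  qed
qed

section \<open>Reduction of the equivalence to residues modulo \<open>d\<close>\<close>

theorem theorem1p1:
  fixes m n d :: nat
  assumes "n < m" and "1 \<le> d" and "d \<le> m"
  shows "(1 + q_var ^ d) dvd (q_euler (2 * m) - q_var ^ (m - n) * q_euler (2 * n))
           \<longleftrightarrow> [m = n] (mod d)"
proof
  assume "[m = n] (mod d)"
  then show "(1 + q_var ^ d) dvd (q_euler (2 * m) - q_var ^ (m - n) * q_euler (2 * n))"
    unfolding q_euler_eq_q_euler_at using assms by (intro q_euler_at_cong) auto
next
  assume dvd: "(1 + q_var ^ d) dvd (q_euler (2 * m) - q_var ^ (m - n) * q_euler (2 * n))"
  define r s where "r = n mod d" and "s = m mod d"
  have rs: "r < d" "s < d" "r \<le> n" "s \<le> m" using assms(2) by (simp_all add: r_def s_def)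
  \<comment> \<open>The order of \<open>r\<close> and \<open>s\<close> is not known, so the relation
    is stated symmetrically, without the exponent \<open>s - r\<close>.\<close>
  have "q_euler_at z s * z ^ r = q_euler_at z r * z ^ s" if z: "z ^ d = -1" for z :: complex
  proof -
    have z0: "z \<noteq> 0" using z assms(2) by (auto simp: power_0_left)
    have m: "q_euler_at z m = z ^ (m - s) * q_euler_at z s"
      using q_euler_at_cong[of d s m] assms(2) rs z
      by (simp add: one_plus_power_dvd_iff s_def cong_def)
    have n: "q_euler_at z n = z ^ (n - r) * q_euler_at z r"
      using q_euler_at_cong[of d r n] assms(2) rs z
      by (simp add: one_plus_power_dvd_iff r_def cong_def)
    have mn: "q_euler_at z m = z ^ (m - n) * q_euler_at z n"
      using dvd assms(2) z unfolding q_euler_eq_q_euler_at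
      by (simp add: one_plus_power_dvd_iff)
    have "z ^ m * (q_euler_at z s * z ^ r) = z ^ s * z ^ r * q_euler_at z m"
      using rs by (simp add: m mult_ac flip: power_add)
    also have "\<dots> = z ^ m * (q_euler_at z r * z ^ s)"
      using rs assms(1) by (simp add: mn n mult_ac flip: power_add)
    finally show ?thesis using z0 by simp
  qed
  note key = this
  have *: False if "a < b" "b < d"
    and ab: "\<And>z :: complex. z ^ d = -1 \<Longrightarrow> q_euler_at z b * z ^ a = q_euler_at z a * z ^ b" for a b
  proof -
    have "q_euler_at z b = z ^ (b - a) * q_euler_at z a" if z: "z ^ d = -1" for z :: complex
    proof -
      have "z \<noteq> 0" using z assms(2) by (auto simp: power_0_left)
      moreover have "z ^ b = z ^ (b - a) * z ^ a"
        using \<open>a < b\<close> by (simp flip: power_add)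
      ultimately show ?thesis
        using ab[OF z] by simp
    qed
    then have "(1 + q_var ^ d) dvd (q_euler_at q_var b - q_var ^ (b - a) * q_euler_at q_var a)"
      using assms(2) by (simp add: one_plus_power_dvd_iff)
    with not_dvd_of_distinct_residues \<open>a < b\<close> \<open>b < d\<close> show False by blast
  qed
  have "r = s"
  proof (rule ccontr)
    assume "r \<noteq> s"
    then consider "r < s" | "s < r" by linarith
    then show False
      by cases (use * key rs in \<open>metis+\<close>)
  qed
  then show "[m = n] (mod d)" by (simp add: r_def s_def cong_def)
qed

end
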